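(* Let $u,v \in \mathbb{N}^*$. Then $u \equiv_{\mathrm{jSt}} v$ if and only if $\mathrm{cont}(u) = \mathrm{cont}(v)$ and $\overline{u} = \overline{v}$.
   Context: $\mathbb{N}=\{1,2,\dots\}$ and $\mathbb{N}^*$ is the free monoid of words over $\mathbb{N}$. For a word $w$, $|w|_x$ is the number of occurrences of the letter $x$ in $w$, and $\mathrm{cont}(w)$ is the function $x\mapsto |w|_x$. A letter $x$ is simple in $w$ if $|w|_x=1$; $\overline{w}$ is the word obtained from $w$ by deleting all letters that are not simple in $w$. The right-stalactic congruence $\equiv_{\mathrm{rSt}}$ is the congruence on $\mathbb{N}^*$ generated by the pairs $(ba\,u\,b,\ ab\,u\,b)$, and the left-stalactic congruence $\equiv_{\mathrm{lSt}}$ is the congruence generated by the pairs $(b\,u\,ab,\ b\,u\,ba)$, with $a,b\in\mathbb{N}$, $u\in\mathbb{N}^*$. The join-stalactic congruence $\equiv_{\mathrm{jSt}}$ is the join of $\equiv_{\mathrm{rSt}}$ and $\equiv_{\mathrm{lSt}}$ in the lattice of congruences of $\mathbb{N}^*$. *)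

theory Defs
  imports "HOL-Library.FuncSet"
begin

definition letters :: "nat set" where
  "letters = {1..}"

definition words :: "nat list set" where
  "words = lists letters"

definition cont :: "nat list \<Rightarrow> nat \<Rightarrow> nat" where
  "cont w = (\<lambda>x\<in>letters. count_list w x)"

definition simple :: "nat \<Rightarrow> nat list \<Rightarrow> bool" where
  "simple x w \<longleftrightarrow> count_list w x = 1"

definition simple_part :: "nat list \<Rightarrow> nat list" where
  "simple_part w = filter (\<lambda>x. simple x w) w"

text \<open>Congruences of the free monoid \<^term>\<open>words\<close>, as sets of pairs;
  \<^const>\<open>equiv\<close> includes the condition that the relation lives on \<^term>\<open>words\<close>.\<close>

definition congruence :: "(nat list \<times> nat list) set \<Rightarrow> bool" where
  "congruence r \<longleftrightarrow> equiv words r \<and>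
     (\<forall>u v u' v'. (u, v) \<in> r \<longrightarrow> (u', v') \<in> r \<longrightarrow> (u @ u', v @ v') \<in> r)"

definition generated_congruence :: "(nat list \<times> nat list) set \<Rightarrow> (nat list \<times> nat list) set" where
  "generated_congruence R = \<Inter> {r. congruence r \<and> R \<subseteq> r}"

text \<open>The join in the lattice of congruences, ordered by inclusion, is the meet of all
  common upper bounds.\<close>

definition congruence_join ::
  "(nat list \<times> nat list) set \<Rightarrow> (nat list \<times> nat list) set \<Rightarrow> (nat list \<times> nat list) set" where
  "congruence_join r s = \<Inter> {t. congruence t \<and> r \<subseteq> t \<and> s \<subseteq> t}"

definition right_stalactic :: "(nat list \<times> nat list) set" where
  "right_stalactic = generated_congruence
     {([b, a] @ u @ [b], [a, b] @ u @ [b]) | a b u. a \<in> letters \<and> b \<in> letters \<and> u \<in> words}"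

definition left_stalactic :: "(nat list \<times> nat list) set" where
  "left_stalactic = generated_congruence
     {([b] @ u @ [a, b], [b] @ u @ [b, a]) | a b u. a \<in> letters \<and> b \<in> letters \<and> u \<in> words}"

definition join_stalactic :: "(nat list \<times> nat list) set" where
  "join_stalactic = congruence_join right_stalactic left_stalactic"

text \<open>The intersections above are over nonempty families and yield congruences.\<close>

lemma congruence_Times_words: "congruence (words \<times> words)"
  by (auto simp: congruence_def words_def equiv_def refl_on_def sym_def trans_def)

lemma congruence_Inter:
  assumes "C \<noteq> {}" and "\<And>r. r \<in> C \<Longrightarrow> congruence r"
  shows "congruence (\<Inter> C)"
proof -
  have "equiv words (\<Inter> C)"
  proof (rule equivI)
    show "\<Inter> C \<subseteq> words \<times> words"
      using assms by (fastforce simp: congruence_def equiv_def)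
    show "refl_on words (\<Inter> C)"
      using assms by (fastforce simp: congruence_def equiv_def refl_on_def)
    show "sym (\<Inter> C)"
      using assms(2) unfolding congruence_def equiv_def sym_def by blast
    show "trans (\<Inter> C)"
      using assms(2) unfolding congruence_def equiv_def trans_def by blast
  qed
  then show ?thesis
    using assms by (simp add: congruence_def)
qed

lemma congruence_generated_congruence:
  assumes "R \<subseteq> words \<times> words"
  shows "congruence (generated_congruence R)"
  unfolding generated_congruence_def
  by (rule congruence_Inter) (use assms congruence_Times_words in auto)

lemma congruence_congruence_join:
  assumes "congruence r" and "congruence s"
  shows "congruence (congruence_join r s)"
  unfolding congruence_join_def
proof (rule congruence_Inter)
  have "r \<subseteq> words \<times> words" "s \<subseteq> words \<times> words"
    using assms by (auto simp: congruence_def equiv_def)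
  then show "{t. congruence t \<and> r \<subseteq> t \<and> s \<subseteq> t} \<noteq> {}"
    using congruence_Times_words by blast
qed auto

lemma congruence_right_stalactic: "congruence right_stalactic"
  unfolding right_stalactic_def
  by (rule congruence_generated_congruence) (auto simp: words_def)

lemma congruence_left_stalactic: "congruence left_stalactic"
  unfolding left_stalactic_def
  by (rule congruence_generated_congruence) (auto simp: words_def)

lemma congruence_join_stalactic: "congruence join_stalactic"
  unfolding join_stalactic_def
  by (intro congruence_congruence_join congruence_right_stalactic congruence_left_stalactic)

end

theory Submission
  imports Defs
begin

text \<open>Two adjacent letters may be exchanged modulo \<^const>\<open>join_stalactic\<close> as soon as one of them is
  not simple, since another occurrence of it lies either to the right or to the left. If
  \<open>u\<close> and \<open>a v\<close> have the same content and the same simple letters in the same order, then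
  the first \<open>a\<close> in \<open>u\<close> can be moved to the front: either \<open>a\<close> is not simple, or it is the first
  simple letter of \<open>u\<close>, so that all letters before it are not simple. Induction on the
  second word, with the letters already placed kept as a prefix, concludes.\<close>

lemma words_append_iff [simp]: "u @ v \<in> words \<longleftrightarrow> u \<in> words \<and> v \<in> words"
  by (auto simp: words_def)

lemma words_Cons_iff [simp]: "a # v \<in> words \<longleftrightarrow> a \<in> letters \<and> v \<in> words"
  by (auto simp: words_def)

lemma Nil_in_words [simp]: "[] \<in> words"
  by (simp add: words_def)

text \<open>\<open>cont\<close> is cut down to \<open>letters\<close>, but this loses nothing on
  \<open>words\<close>: any number outside \<open>letters\<close> has count zero in both
  words.\<close>

lemma cont_eq_iff:
  assumes "u \<in> words" and "v \<in> words"
  shows "cont u = cont v \<longleftrightarrow> count_list u = count_list v"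
proof
  assume eq: "cont u = cont v"
  show "count_list u = count_list v"
  proof
    fix x
    show "count_list u x = count_list v x"
    proof (cases "x \<in> letters")
      case True
      then show ?thesis using fun_cong[OF eq, of x] by (simp add: cont_def)
    next
      case False
      then have "x \<notin> set u" "x \<notin> set v" using assms by (auto simp: words_def)
      then show ?thesis by (simp add: count_list_0_iff)
    qed
  qed
qed (simp add: cont_def)

lemma set_eq_if_count_list_eq: "count_list u = count_list v \<Longrightarrow> set u = set v"
  by (metis count_list_0_iff subsetI subset_antisym)

lemma count_list_append_fun: "count_list (u @ v) = (\<lambda>x. count_list u x + count_list v x)"
  by auto

text \<open>A letter is simple in a product exactly when it is simple in one factor and absent from
  the other. Thus the simple part of a product depends only on the simple parts and letter sets of
  its factors, which makes \<open>cont_simple_rel\<close> compatible with concatenation.\<close>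

lemma simple_part_append:
  "simple_part (u @ v) =
     filter (\<lambda>x. x \<notin> set v) (simple_part u) @ filter (\<lambda>x. x \<notin> set u) (simple_part v)"
proof -
  have "simple x (u @ v) \<longleftrightarrow> x \<notin> set v \<and> simple x u" if "x \<in> set u" for x
    using that count_list_0_iff[of u x] count_list_0_iff[of v x] by (auto simp: simple_def)
  moreover have "simple x (u @ v) \<longleftrightarrow> x \<notin> set u \<and> simple x v" if "x \<in> set v" for x
    using that count_list_0_iff[of u x] count_list_0_iff[of v x] by (auto simp: simple_def)
  ultimately show ?thesis
    by (simp add: simple_part_def conj_commute cong: filter_cong)
qed

definition cont_simple_rel :: "(nat list \<times> nat list) set" where
  "cont_simple_rel =
     {(u, v) \<in> words \<times> words. count_list u = count_list v \<and> simple_part u = simple_part v}"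

lemma congruence_cont_simple_rel: "congruence cont_simple_rel"
proof -
  have "equiv words cont_simple_rel"
    by (rule equivI) (auto simp: cont_simple_rel_def refl_on_def sym_def trans_def)
  moreover have "(u @ u', v @ v') \<in> cont_simple_rel"
    if "(u, v) \<in> cont_simple_rel" "(u', v') \<in> cont_simple_rel" for u v u' v'
    using that set_eq_if_count_list_eq[of u v] set_eq_if_count_list_eq[of u' v']
    by (auto simp: cont_simple_rel_def simple_part_append count_list_append_fun)
  ultimately show ?thesis by (simp add: congruence_def)
qed

text \<open>By minimality of generated congruences and of the join, only the generating pairs need
  checking. There \<open>b\<close> occurs at least twice, so deleting non-simple letters removes it
  and with it the difference in order.\<close>

lemma join_stalactic_subset: "join_stalactic \<subseteq> cont_simple_rel"
proof -
  have "right_stalactic \<subseteq> cont_simple_rel"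
    unfolding right_stalactic_def generated_congruence_def
  proof (rule Inter_lower, simp add: congruence_cont_simple_rel, safe)
    fix a b u assume "a \<in> letters" "b \<in> letters" "u \<in> words"
    then show "(b # a # u @ [b], a # b # u @ [b]) \<in> cont_simple_rel"
      by (auto simp: cont_simple_rel_def simple_part_def simple_def intro!: filter_cong)
  qed
  moreover have "left_stalactic \<subseteq> cont_simple_rel"
    unfolding left_stalactic_def generated_congruence_def
  proof (rule Inter_lower, simp add: congruence_cont_simple_rel, safe)
    fix a b u assume "a \<in> letters" "b \<in> letters" "u \<in> words"
    then show "(b # u @ [a, b], b # u @ [b, a]) \<in> cont_simple_rel"
      by (auto simp: cont_simple_rel_def simple_part_def simple_def intro!: filter_cong)
  qed
  ultimately show ?thesis
    unfolding join_stalactic_def congruence_join_def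
    using congruence_cont_simple_rel by blast
qed

lemma join_stalactic_refl: "u \<in> words \<Longrightarrow> (u, u) \<in> join_stalactic"
  using congruence_join_stalactic by (auto simp: congruence_def equiv_def refl_on_def)

lemma join_stalactic_sym: "(u, v) \<in> join_stalactic \<Longrightarrow> (v, u) \<in> join_stalactic"
  using congruence_join_stalactic by (auto simp: congruence_def equiv_def dest: symD)

lemma join_stalactic_trans:
  "(u, v) \<in> join_stalactic \<Longrightarrow> (v, w) \<in> join_stalactic \<Longrightarrow> (u, w) \<in> join_stalactic"
  using congruence_join_stalactic by (auto simp: congruence_def equiv_def dest: transD)

lemma join_stalactic_context:
  assumes "(u, v) \<in> join_stalactic" and "p \<in> words" and "q \<in> words"
  shows "(p @ u @ q, p @ v @ q) \<in> join_stalactic"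
  using congruence_join_stalactic assms join_stalactic_refl unfolding congruence_def by blast

lemma right_rule_in_join_stalactic:
  assumes "a \<in> letters" "b \<in> letters" "u \<in> words"
  shows "([b, a] @ u @ [b], [a, b] @ u @ [b]) \<in> join_stalactic"
  using assms unfolding join_stalactic_def congruence_join_def right_stalactic_def
    generated_congruence_def by blast

lemma left_rule_in_join_stalactic:
  assumes "a \<in> letters" "b \<in> letters" "u \<in> words"
  shows "([b] @ u @ [a, b], [b] @ u @ [b, a]) \<in> join_stalactic"
  using assms unfolding join_stalactic_def congruence_join_def left_stalactic_def
    generated_congruence_def by blast

lemma join_stalactic_swap_if_occurs:
  assumes "p \<in> words" "q \<in> words" "a \<in> letters" "b \<in> letters" and "b \<in> set p \<union> set q"
  shows "(p @ [b, a] @ q, p @ [a, b] @ q) \<in> join_stalactic"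
proof (cases "b \<in> set q")
  case True
  then obtain r s where q: "q = r @ b # s" by (meson split_list)
  show ?thesis
    using join_stalactic_context[OF right_rule_in_join_stalactic[of a b r], of p s] assms q by simp
next
  case False
  then obtain r s where p: "p = r @ b # s" using assms(5) by (auto dest: split_list)
  \<comment> \<open>The left rule turns \<open>ab\<close> into \<open>ba\<close>, so it is applied
    backwards here.\<close>
  show ?thesis
    using join_stalactic_sym[OF join_stalactic_context[OF left_rule_in_join_stalactic[of a b s],
      of r q]] assms p by simp
qed

lemma join_stalactic_swap:
  assumes "p @ [c, a] @ q \<in> words"
    and "\<not> simple a (p @ [c, a] @ q) \<or> \<not> simple c (p @ [c, a] @ q)"
  shows "(p @ [c, a] @ q, p @ [a, c] @ q) \<in> join_stalactic"
proof (cases "a = c")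
  case True
  then show ?thesis using assms(1) by (simp add: join_stalactic_refl)
next
  case False
  \<comment> \<open>As \<open>a\<close> and \<open>c\<close> differ, the displayed pair contains
    each once; whichever is not simple recurs in \<open>p\<close> or \<open>q\<close>.\<close>
  then have "c \<in> set p \<union> set q \<or> a \<in> set p \<union> set q"
    using assms(2) by (auto simp: simple_def count_list_0_iff)
  then show ?thesis
    using assms(1) join_stalactic_swap_if_occurs[of p q a c]
      join_stalactic_sym[OF join_stalactic_swap_if_occurs[of p q c a]] by auto
qed

lemma join_stalactic_move:
  assumes "p @ x @ [a] @ y \<in> words"
    and "\<forall>c\<in>set x. \<not> simple a (p @ x @ [a] @ y) \<or> \<not> simple c (p @ x @ [a] @ y)"
  shows "(p @ x @ [a] @ y, p @ [a] @ x @ y) \<in> join_stalactic"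
  using assms
proof (induction x arbitrary: y rule: rev_induct)
  case Nil
  then show ?case by (simp add: join_stalactic_refl)
next
  case (snoc c x)
  have "((p @ x) @ [c, a] @ y, (p @ x) @ [a, c] @ y) \<in> join_stalactic"
    by (rule join_stalactic_swap) (use snoc.prems in auto)
  moreover have "(p @ x @ [a] @ (c # y), p @ [a] @ x @ (c # y)) \<in> join_stalactic"
  proof (rule snoc.IH)
    \<comment> \<open>Once \<open>a\<close> has passed \<open>c\<close>, the letter \<open>c\<close>
      joins the right context; counts, and so simplicity, are unchanged.\<close>
    have "simple z (p @ x @ [a] @ c # y) = simple z (p @ (x @ [c]) @ [a] @ y)" for z
      by (auto simp: simple_def)
    then show "\<forall>z\<in>set x. \<not> simple a (p @ x @ [a] @ c # y) \<or> \<not> simple z (p @ x @ [a] @ c # y)"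
      using snoc.prems(2) by auto
  qed (use snoc.prems in auto)
  ultimately show ?case by (auto intro: join_stalactic_trans)
qed

text \<open>Simplicity is measured in \<open>p @ u\<close>, not in \<open>u\<close>: a letter
  occurring once in \<open>u\<close> may still be exchanged freely if it also occurs in
  \<open>p\<close>. This keeps the hypothesis stable when a letter passes from \<open>u\<close> to
  \<open>p\<close>.\<close>

lemma join_stalactic_if_same_prefix:
  assumes "p @ u \<in> words"
    and "count_list u = count_list v"
    and "filter (\<lambda>x. simple x (p @ u)) u = filter (\<lambda>x. simple x (p @ u)) v"
  shows "(p @ u, p @ v) \<in> join_stalactic"
  using assms
proof (induction v arbitrary: p u)
  case Nil
  then have "u = []" using set_eq_if_count_list_eq[OF Nil.prems(2)] by simp
  then show ?case using Nil.prems by (simp add: join_stalactic_refl)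
next
  case (Cons a v)
  have "a \<in> set u" using set_eq_if_count_list_eq[OF Cons.prems(2)] by simp
  then obtain x y where u: "u = x @ a # y" and "a \<notin> set x" by (meson split_list_first)
  let ?S = "\<lambda>z. simple z (p @ u)"
  have filters: "filter ?S x @ filter ?S (a # y) = filter ?S (a # v)"
    using Cons.prems(3) by (simp add: u)
  \<comment> \<open>If \<open>a\<close> is simple, the right side of \<open>filters\<close> starts
    with \<open>a\<close>, whereas a nonempty \<open>filter ?S x\<close> would start with a letter
    of \<open>x\<close>, which avoids \<open>a\<close>.\<close>
  have front: "filter ?S x = []" if "?S a"
  proof (rule ccontr)
    assume "filter ?S x \<noteq> []"
    then have "hd (filter ?S x) = a"
      using arg_cong[OF filters, of hd] that by simp
    then show False
      using \<open>filter ?S x \<noteq> []\<close> \<open>a \<notin> set x\<close> by (metis filter_is_subset hd_in_set subsetD)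
  qed
  have move: "(p @ x @ [a] @ y, p @ [a] @ x @ y) \<in> join_stalactic"
    by (rule join_stalactic_move) (use Cons.prems(1) front in \<open>auto simp: u filter_empty_conv\<close>)
  have "((p @ [a]) @ x @ y, (p @ [a]) @ v) \<in> join_stalactic"
  proof (rule Cons.IH)
    show "count_list (x @ y) = count_list v"
    proof
      fix z
      show "count_list (x @ y) z = count_list v z"
        using fun_cong[OF Cons.prems(2), of z] by (auto simp: u split: if_splits)
    qed
    have "simple z ((p @ [a]) @ x @ y) = ?S z" for z
      by (auto simp: simple_def u)
    \<comment> \<open>If \<open>a\<close> is simple, it heads both sides of \<open>filters\<close>
      and cancels; otherwise neither side retains it.\<close>
    moreover have "filter ?S (x @ y) = filter ?S v"
      using filters front by (cases "?S a") auto
    ultimately show "filter (\<lambda>z. simple z ((p @ [a]) @ x @ y)) (x @ y) =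
        filter (\<lambda>z. simple z ((p @ [a]) @ x @ y)) v"
      by presburger
  qed (use Cons.prems(1) in \<open>simp add: u\<close>)
  then show ?case using join_stalactic_trans[OF move] by (simp add: u)
qed

theorem proposition3p2:
  fixes u v :: "nat list"
  assumes "u \<in> words" and "v \<in> words"
  shows "(u, v) \<in> join_stalactic \<longleftrightarrow> cont u = cont v \<and> simple_part u = simple_part v"
proof
  assume "(u, v) \<in> join_stalactic"
  then show "cont u = cont v \<and> simple_part u = simple_part v"
    using join_stalactic_subset cont_eq_iff[OF assms] by (auto simp: cont_simple_rel_def)
next
  assume eq: "cont u = cont v \<and> simple_part u = simple_part v"
  then have counts: "count_list u = count_list v"
    using cont_eq_iff[OF assms] by blast
  \<comment> \<open>Equal counts make the same letters simple in \<open>u\<close> and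
    \<open>v\<close>, so both simple parts are filters by one predicate.\<close>
  have "([] @ u, [] @ v) \<in> join_stalactic"
    by (rule join_stalactic_if_same_prefix)
      (use assms eq counts in \<open>simp_all add: simple_part_def simple_def\<close>)
  then show "(u, v) \<in> join_stalactic" by simp
qed

end
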